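(* Let $(\Phi^{(j)})_{j=1}^\infty$ be a non-autonomous IFS on a compact metric space $X$ with limit set $J$ and associated nerves $\mathcal N_{0,k}$ ($k\ge1$). There is a bijection $\mathrm{Con}(J)\to\varprojlim_k\mathrm{Con}(\mathcal N_{0,k})$. More explicitly, each $C\in\mathrm{Con}(J)$ is mapped to the sequence of $\mathcal C_k\in\mathrm{Con}(\mathcal N_{0,k})$ such that $$C\subset\bigcup_{v\in V(\mathcal C_k)}f_v(J_k)$$ for every $k>0$.
   Context: Let $X$ be a non-empty compact metric space; $\mathrm{Lip}(f)$ denotes the Lipschitz constant of $f\colon X\to X$. A non-autonomous IFS $(\Phi^{(j)})_{j\ge1}$ on $X$ is a sequence of collections $\Phi^{(j)}=\{f^{(j)}_i\colon X\to X\}_{i\in I^{(j)}}$ of maps, with each index set $I^{(j)}$ finite and non-empty, such that there is a constant $c<1$ with $\mathrm{Lip}(f^{(j)}_i)\le c$ for all $j\ge1$, $i\in I^{(j)}$. Its coding map $\Pi\colon\prod_{j\ge1}I^{(j)}\to X$ is defined by $\{\Pi(i_1,i_2,\dots)\}=\bigcap_{j\ge1}f^{(1)}_{i_1}\circ\cdots\circ f^{(j)}_{i_j}(X)$, and its limit set is $J=\Pi(\prod_{j\ge1}I^{(j)})$. For $j\ge0$, $J_j$ denotes the limit set of the shifted system $(\Phi^{(j+k)})_{k\ge1}$, so $J_0=J$. For $0\le j<k$ and $v=(i_{j+1},\dots,i_k)\in I^{(j+1)}\times\cdots\times I^{(k)}$ put $f_v=f^{(j+1)}_{i_{j+1}}\circ\cdots\circ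 f^{(k)}_{i_k}$. The nerve $\mathcal N_{j,k}$ is the abstract simplicial complex with vertex set $I^{(j+1)}\times\cdots\times I^{(k)}$, in which a set $\{v_0,\dots,v_q\}$ of mutually distinct vertices is a simplex iff $\bigcap_{p=0}^q f_{v_p}(J_k)\ne\emptyset$. For a simplicial complex $\mathcal K$ with vertex set $V(\mathcal K)$, let $\sim$ be the equivalence relation on $V(\mathcal K)$ generated by $u\sim v$ whenever $\{u,v\}$ is a 1-simplex. A component of $\mathcal K$ is a subcomplex $\mathcal K_v=\{s\in\mathcal K : s\subset[v]\}$, where $[v]$ is the class of $v$; $\mathrm{Con}(\mathcal K)$ is the set of components. The simplicial map $\phi\colon\mathcal N_{0,k+1}\to\mathcal N_{0,k}$, $(i_1,\dots,i_{k+1})\mapsto(i_1,\dots,i_k)$, induces maps $\phi_*\colon\mathrm{Con}(\mathcal N_{0,k+1})\to\mathrm{Con}(\mathcal N_{0,k})$, $\mathcal K_v\mapsto\mathcal K_{\phi(v)}$, along which the inverse limit of sets is taken. For a topological space $Y$, $\mathrm{Con}(Y)$ is the set of its connected components. *)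

theory Defs
  imports "HOL-Analysis.Analysis"
begin

section \<open>Non-autonomous iterated function systems\<close>

text \<open>
  The ambient compact metric space is a subset \<open>X\<close> of a metric type; the maps are total functions of
  which only the restriction to \<open>X\<close> matters. Levels are numbered from 1, and \<open>I 0\<close>, \<open>f 0\<close> are
  ignored.
\<close>

locale nonautonomous_ifs =
  fixes X :: "'a::metric_space set"
    and I :: "nat \<Rightarrow> 'i set"
    and f :: "nat \<Rightarrow> 'i \<Rightarrow> 'a \<Rightarrow> 'a"
  assumes compact_space: "compact X"
    and nonempty_space: "X \<noteq> {}"
    and finite_index: "j \<ge> 1 \<Longrightarrow> finite (I j)"
    and nonempty_index: "j \<ge> 1 \<Longrightarrow> I j \<noteq> {}"
    and self_maps: "j \<ge> 1 \<Longrightarrow> i \<in> I j \<Longrightarrow> f j i \<in> X \<rightarrow> X"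
    and uniformly_contracting: "\<exists>c<1. \<forall>j\<ge>1. \<forall>i\<in>I j. c-lipschitz_on X (f j i)"

text \<open>
  Words in \<open>I (j+1) \<times> \<dots> \<times> I k\<close> keep the level as their index: they are functions on \<open>{j+1, \<dots>, k}\<close>
  (extended by \<open>undefined\<close>).
\<close>

definition words :: "(nat \<Rightarrow> 'i set) \<Rightarrow> nat \<Rightarrow> nat \<Rightarrow> (nat \<Rightarrow> 'i) set" where
  "words I j k = Pi\<^sub>E {j<..k} I"

text \<open>\<open>f (j+1) (v (j+1)) \<circ> \<dots> \<circ> f k (v k)\<close>\<close>

definition word_map :: "(nat \<Rightarrow> 'i \<Rightarrow> 'a \<Rightarrow> 'a) \<Rightarrow> nat \<Rightarrow> nat \<Rightarrow> (nat \<Rightarrow> 'i) \<Rightarrow> 'a \<Rightarrow> 'a" where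
  "word_map f j k v = foldr (\<lambda>l g. f l (v l) \<circ> g) [Suc j..<Suc k] id"

definition coding_map :: "'a set \<Rightarrow> (nat \<Rightarrow> 'i \<Rightarrow> 'a \<Rightarrow> 'a) \<Rightarrow> (nat \<Rightarrow> 'i) \<Rightarrow> 'a" where
  "coding_map X f w = (THE x. (\<Inter>j\<in>{1..}. word_map f 0 j w ` X) = {x})"

definition limit_set :: "'a set \<Rightarrow> (nat \<Rightarrow> 'i set) \<Rightarrow> (nat \<Rightarrow> 'i \<Rightarrow> 'a \<Rightarrow> 'a) \<Rightarrow> 'a set" where
  "limit_set X I f = coding_map X f ` Pi\<^sub>E {1..} I"

definition shifted_limit_set ::
  "'a set \<Rightarrow> (nat \<Rightarrow> 'i set) \<Rightarrow> (nat \<Rightarrow> 'i \<Rightarrow> 'a \<Rightarrow> 'a) \<Rightarrow> nat \<Rightarrow> 'a set" where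
  "shifted_limit_set X I f j = limit_set X (\<lambda>k. I (j + k)) (\<lambda>k. f (j + k))"

section \<open>Simplicial complexes and their components\<close>

text \<open>
  A simplicial complex is represented by its set of (non-empty, finite) simplices; every vertex is
  a simplex, so the vertex set is their union.
\<close>

definition vertices :: "'v set set \<Rightarrow> 'v set" where
  "vertices K = \<Union>K"

definition vertex_class :: "'v set set \<Rightarrow> 'v \<Rightarrow> 'v set" where
  "vertex_class K v = {u \<in> vertices K. equivclp (\<lambda>x y. x \<noteq> y \<and> {x, y} \<in> K) v u}"

definition complex_component :: "'v set set \<Rightarrow> 'v \<Rightarrow> 'v set set" where
  "complex_component K v = {s \<in> K. s \<subseteq> vertex_class K v}"

definition complex_components :: "'v set set \<Rightarrow> 'v set set set" where
  "complex_components K = complex_component K ` vertices K"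

text \<open>The map on components induced by a simplicial map \<open>\<phi>\<close> from \<open>K\<close> to \<open>L\<close>.\<close>

definition component_map ::
  "'v set set \<Rightarrow> 'w set set \<Rightarrow> ('v \<Rightarrow> 'w) \<Rightarrow> 'v set set \<Rightarrow> 'w set set" where
  "component_map K L \<phi> C =
    (THE D. \<exists>v\<in>vertices K. C = complex_component K v \<and> D = complex_component L (\<phi> v))"

lemma component_map_complex_component:
  assumes simplicial: "\<And>s. s \<in> K \<Longrightarrow> \<phi> ` s \<in> L"
    and vertex_simplex: "\<And>u. u \<in> vertices K \<Longrightarrow> {u} \<in> K"
    and v: "v \<in> vertices K"
  shows "component_map K L \<phi> (complex_component K v) = complex_component L (\<phi> v)"
proof -
  define E where "E = (\<lambda>x y. x \<noteq> y \<and> {x, y} \<in> K)"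
  define F where "F = (\<lambda>x y. x \<noteq> y \<and> {x, y} \<in> L)"
  have push: "equivclp F (\<phi> x) (\<phi> y)" if "equivclp E x y" for x y
    using that
  proof (induction rule: equivclp_induct)
    case base
    show ?case by simp
  next
    case (step y z)
    have "\<phi> ` {y, z} \<in> L \<or> \<phi> ` {z, y} \<in> L"
      using step.hyps(2) simplicial unfolding E_def by blast
    then have "equivclp F (\<phi> y) (\<phi> z)"
      by (cases "\<phi> y = \<phi> z") (auto simp: F_def insert_commute)
    with step.IH show ?case by (rule equivclp_trans)
  qed
  have "complex_component L (\<phi> u) = complex_component L (\<phi> v)"
    if "u \<in> vertices K" "complex_component K v = complex_component K u" for u
  proof -
    have "{u} \<in> complex_component K u"
      using that(1) vertex_simplex by (auto simp: complex_component_def vertex_class_def)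
    then have "u \<in> vertex_class K v"
      using that(2) by (auto simp: complex_component_def)
    then have "equivclp F (\<phi> v) (\<phi> u)"
      by (intro push) (simp add: vertex_class_def E_def)
    then have "vertex_class L (\<phi> u) = vertex_class L (\<phi> v)"
      unfolding vertex_class_def F_def by (blast intro: equivclp_trans equivclp_sym)
    then show ?thesis by (simp add: complex_component_def)
  qed
  with v show ?thesis
    unfolding component_map_def by (intro the_equality) blast+
qed

section \<open>Nerves\<close>

definition nerve ::
  "'a set \<Rightarrow> (nat \<Rightarrow> 'i set) \<Rightarrow> (nat \<Rightarrow> 'i \<Rightarrow> 'a \<Rightarrow> 'a) \<Rightarrow> nat \<Rightarrow> nat \<Rightarrow> (nat \<Rightarrow> 'i) set set" where
  "nerve X I f j k =
    {s. s \<noteq> {} \<and> finite s \<and> s \<subseteq> words I j k \<and>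
        (\<Inter>v\<in>s. word_map f j k v ` shifted_limit_set X I f k) \<noteq> {}}"

lemma (in nonautonomous_ifs) vertices_nerve: "vertices (nerve X I f j k) = words I j k"
proof -
  have "shifted_limit_set X I f k \<noteq> {}"
    by (auto simp: shifted_limit_set_def limit_set_def PiE_eq_empty_iff nonempty_index)
  then have "{v} \<in> nerve X I f j k" if "v \<in> words I j k" for v
    unfolding nerve_def using that by simp
  then have "words I j k \<subseteq> vertices (nerve X I f j k)"
    unfolding vertices_def by blast
  moreover have "vertices (nerve X I f j k) \<subseteq> words I j k"
    by (auto simp: vertices_def nerve_def)
  ultimately show ?thesis by blast
qed

definition nerve_components ::
  "'a set \<Rightarrow> (nat \<Rightarrow> 'i set) \<Rightarrow> (nat \<Rightarrow> 'i \<Rightarrow> 'a \<Rightarrow> 'a) \<Rightarrow> nat \<Rightarrow> (nat \<Rightarrow> 'i) set set set" where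
  "nerve_components X I f k = complex_components (nerve X I f 0 k)"

text \<open>Induced by the truncation \<open>(i\<^sub>1, \<dots>, i\<^sub>k\<^sub>+\<^sub>1) \<mapsto> (i\<^sub>1, \<dots>, i\<^sub>k)\<close>.\<close>

definition bonding_map ::
  "'a set \<Rightarrow> (nat \<Rightarrow> 'i set) \<Rightarrow> (nat \<Rightarrow> 'i \<Rightarrow> 'a \<Rightarrow> 'a) \<Rightarrow> nat \<Rightarrow>
    (nat \<Rightarrow> 'i) set set \<Rightarrow> (nat \<Rightarrow> 'i) set set" where
  "bonding_map X I f k =
    component_map (nerve X I f 0 (Suc k)) (nerve X I f 0 k) (\<lambda>v. restrict v {0<..k})"

text \<open>Inverse limit of sets \<open>A 1 \<leftarrow> A 2 \<leftarrow> \<dots>\<close>, where \<open>p k\<close> maps \<open>A (k+1)\<close> to \<open>A k\<close>.\<close>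

definition inverse_limit :: "(nat \<Rightarrow> 'b set) \<Rightarrow> (nat \<Rightarrow> 'b \<Rightarrow> 'b) \<Rightarrow> (nat \<Rightarrow> 'b) set" where
  "inverse_limit A p = {s \<in> Pi\<^sub>E {1..} A. \<forall>k\<ge>1. p k (s (Suc k)) = s k}"

end

theory Submission
  imports Defs
begin

text \<open>
  Write \<open>J\<^sub>k\<close> for the limit set of the system shifted by \<open>k\<close>, and \<open>J = J\<^sub>0\<close>. The argument uses only
  the following properties of the pieces \<open>f\<^sub>v(J\<^sub>k)\<close>, where \<open>v\<close> is a word of length \<open>k\<close>: they are
  compact and non-empty, there are finitely many of them for each \<open>k\<close>, their union is \<open>J\<close>
  (\<open>limit_set_eq_pieces\<close>), the piece of a word lies in the piece of its truncation (\<open>piece_Suc\<close>), and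
  their diameters tend to 0 uniformly in \<open>v\<close> (\<open>pieces_small\<close>). All of this comes from
  \<open>J\<^sub>k = (\<Union>i. f\<^sub>i(J\<^sub>k\<^sub>+\<^sub>1))\<close> and from compactness of the limit set.

  Two pieces meet exactly when their words are equal or adjacent in the nerve. Hence, if the body of
  a component of the nerve is the union of its pieces, the bodies at level \<open>k\<close> partition \<open>J\<close> into
  finitely many compact sets, and every connected component \<open>C\<close> of \<open>J\<close> lies in exactly one body
  (\<open>connected_in_unique_body\<close>). The bodies shrink along the bonding maps, so these choices form a
  thread in the inverse limit.

  The assignment is injective: two different components of the compact space \<open>J\<close> are different
  quasi-components, so they are separated by a partition of \<open>J\<close> into two sets at a distance
  \<open>\<delta> > 0\<close>; once all pieces have diameter less than \<open>\<delta>\<close>, no path in the nerve crosses from one set to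
  the other (\<open>components_in_different_bodies\<close>). It is surjective: the bodies of a thread are nested
  non-empty compact sets, so they have a common point (\<open>inverse_limit_bodies_meet\<close>), and the
  component of that point is mapped to the given thread. In particular it is not necessary to know
  that the intersection of the bodies is connected.
\<close>

section \<open>Compact sets\<close>

lemma nested_compact_Inter_nonempty:
  fixes K :: "nat \<Rightarrow> 'a::t2_space set"
  assumes compact: "\<And>n. compact (K n)" and nonempty: "\<And>n. K n \<noteq> {}"
    and nested: "\<And>n. K (Suc n) \<subseteq> K n"
  shows "(\<Inter>n. K n) \<noteq> {}"
proof (rule compact_space_imp_nest)
  have dec: "decseq K"
    using nested by (simp add: decseq_Suc_iff)
  then show "decseq K" .
  show "compact_space (top_of_set (K 0))"
    using compact[of 0] by (simp add: compact_space_subtopology)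
  show "closedin (top_of_set (K 0)) (K n)" for n
    using compact[of n] dec by (intro closed_subset) (auto simp: compact_imp_closed decseq_def)
qed (rule nonempty)

text \<open>In a compact Hausdorff space the components agree with the quasi-components.\<close>

lemma components_compact_separated:
  fixes S :: "'a::metric_space set"
  assumes "compact S" and C: "C \<in> components S" and C': "C' \<in> components S" and "C \<noteq> C'"
  obtains A B \<delta> where "A \<union> B = S" "C \<inter> A \<noteq> {}" "C' \<inter> B \<noteq> {}" "\<delta> > 0"
    "\<And>a b. a \<in> A \<Longrightarrow> b \<in> B \<Longrightarrow> \<delta> \<le> dist a b"
proof -
  obtain x where x: "x \<in> S" "C = connected_component_set S x"
    using C by (auto simp: components_def)
  obtain y where y: "y \<in> S" "C' = connected_component_set S y"
    using C' by (auto simp: components_def)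
  \<comment> \<open>A clopen \<open>A\<close> separates \<open>x\<close> from \<open>y\<close>; the distance of \<open>A\<close> and its complement is attained.\<close>
  have "\<not> connected_component S x y"
    using x y \<open>C \<noteq> C'\<close> connected_component_eq by fastforce
  moreover have "quasi_component_of (top_of_set S) x = connected_component_of (top_of_set S) x"
    using \<open>compact S\<close>
    by (intro quasi_eq_connected_component_of)
      (auto simp: compact_space_subtopology Hausdorff_space_subtopology)
  moreover have "connected_component_of (top_of_set S) x y \<longleftrightarrow> connected_component S x y"
    by (auto simp: connected_component_of_def connected_component_def connectedin_subtopology)
  ultimately have "\<not> quasi_component_of (top_of_set S) x y"
    by simp
  then obtain A where A: "x \<in> A" "y \<notin> A" "closedin (top_of_set S) A" "openin (top_of_set S) A"
    using x y by (auto simp: quasi_component_of)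
  define B where "B = S - A"
  have B: "closedin (top_of_set S) B"
    using A by (simp add: B_def closedin_diff)
  have comp: "compact A" "compact B"
    using A B \<open>compact S\<close> closedin_compact by blast+
  have AB: "A \<union> B = S" "A \<inter> B = {}"
    using A closedin_imp_subset by (auto simp: B_def)
  have xy: "x \<in> C" "y \<in> C'" "y \<in> B"
    using x y A by (auto simp: B_def)
  have "\<exists>p\<in>A \<times> B. \<forall>q\<in>A \<times> B. dist (fst p) (snd p) \<le> dist (fst q) (snd q)"
    using comp A xy
    by (intro continuous_attains_inf) (auto intro!: compact_Times continuous_intros)
  then obtain p where p: "p \<in> A \<times> B" "\<forall>q\<in>A \<times> B. dist (fst p) (snd p) \<le> dist (fst q) (snd q)"
    by blast
  show thesis
  proof (rule that)
    show "0 < dist (fst p) (snd p)"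
      using p AB by auto
    show "dist (fst p) (snd p) \<le> dist a b" if "a \<in> A" "b \<in> B" for a b
      using p that by auto
  qed (use AB A xy in auto)
qed

section \<open>Word maps and limit sets\<close>

lemma foldr_comp_id: "foldr (\<lambda>l g. h l \<circ> g) ls g = foldr (\<lambda>l g. h l \<circ> g) ls id \<circ> g"
  by (induction ls) (simp_all add: o_assoc[symmetric])

lemma word_map_same [simp]: "word_map f j j v = id"
  by (simp add: word_map_def)

lemma word_map_Suc:
  "j \<le> k \<Longrightarrow> word_map f j (Suc k) v = word_map f j k v \<circ> f (Suc k) (v (Suc k))"
proof -
  assume "j \<le> k"
  then have "word_map f j (Suc k) v
      = foldr (\<lambda>l g. f l (v l) \<circ> g) [Suc j..<Suc k] (f (Suc k) (v (Suc k)))"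
    by (simp add: word_map_def)
  also have "\<dots> = word_map f j k v \<circ> f (Suc k) (v (Suc k))"
    unfolding word_map_def by (rule foldr_comp_id)
  finally show ?thesis .
qed

lemma word_map_cong:
  "(\<And>l. l \<in> {j<..k} \<Longrightarrow> v l = w l) \<Longrightarrow> word_map f j k v = word_map f j k w"
  unfolding word_map_def by (intro foldr_cong) auto

lemma word_map_shift:
  "word_map f 0 (Suc k) v = f 1 (v 1) \<circ> word_map (\<lambda>l. f (Suc l)) 0 k (\<lambda>l. v (Suc l))"
proof (induction k)
  case (Suc k)
  then show ?case
    by (simp only: word_map_Suc[of 0] le0 o_assoc)
qed (simp add: word_map_Suc)

lemma coding_map_cong:
  assumes "\<And>l. l \<ge> 1 \<Longrightarrow> v l = w l"
  shows "coding_map X f v = coding_map X f w"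
proof -
  have "word_map f 0 j v = word_map f 0 j w" for j
    using assms by (intro word_map_cong) auto
  then show ?thesis by (simp add: coding_map_def)
qed

lemma shifted_limit_set_0: "shifted_limit_set X I f 0 = limit_set X I f"
  by (simp add: shifted_limit_set_def)

context nonautonomous_ifs
begin

lemma shifted_ifs: "nonautonomous_ifs X (\<lambda>l. I (s + l)) (\<lambda>l. f (s + l))"
proof
  obtain c where "c < 1" "\<forall>j\<ge>1. \<forall>i\<in>I j. c-lipschitz_on X (f j i)"
    using uniformly_contracting by blast
  then show "\<exists>c<1. \<forall>j\<ge>1. \<forall>i\<in>I (s + j). c-lipschitz_on X (f (s + j) i)"
    by (intro exI[of _ c]) simp
qed (use compact_space nonempty_space finite_index nonempty_index self_maps in auto)

lemma word_map_in_space: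
  "v \<in> Pi {0<..k} I \<Longrightarrow> x \<in> X \<Longrightarrow> word_map f 0 k v x \<in> X"
proof (induction k arbitrary: x)
  case (Suc k)
  have "f (Suc k) (v (Suc k)) x \<in> X"
    using Suc.prems self_maps[of "Suc k" "v (Suc k)"] by (auto simp: Pi_iff)
  moreover have "v \<in> Pi {0<..k} I"
    using Suc.prems by auto
  ultimately show ?case
    using Suc.IH by (simp add: word_map_Suc)
qed simp

lemma word_maps_contract:
  obtains c where "0 \<le> c" "c < 1"
    "\<And>k v. v \<in> Pi {0<..k} I \<Longrightarrow> (c ^ k)-lipschitz_on X (word_map f 0 k v)"
proof -
  obtain c where c: "c < 1" "\<And>j i. j \<ge> 1 \<Longrightarrow> i \<in> I j \<Longrightarrow> c-lipschitz_on X (f j i)"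
    using uniformly_contracting by blast
  have "0 \<le> c"
    using c(2)[of 1] nonempty_index[of 1] lipschitz_on_nonneg by fastforce
  moreover have "(c ^ k)-lipschitz_on X (word_map f 0 k v)" if "v \<in> Pi {0<..k} I" for k v
    using that
  proof (induction k)
    case 0
    show ?case by (simp add: lipschitz_on_def)
  next
    case (Suc k)
    have v: "v (Suc k) \<in> I (Suc k)" "v \<in> Pi {0<..k} I"
      using Suc.prems by auto
    have "f (Suc k) (v (Suc k)) ` X \<subseteq> X"
      using self_maps[of "Suc k" "v (Suc k)"] v by auto
    then have "(c ^ k * c)-lipschitz_on X (word_map f 0 k v \<circ> f (Suc k) (v (Suc k)))"
      using Suc.IH v c(2)[of "Suc k"]
      by (intro lipschitz_on_compose) (auto intro: lipschitz_on_subset)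
    then show ?case by (simp add: word_map_Suc mult.commute)
  qed
  ultimately show thesis using c(1) that by blast
qed

lemma continuous_on_word_map: "v \<in> Pi {0<..k} I \<Longrightarrow> continuous_on X (word_map f 0 k v)"
  using word_maps_contract lipschitz_on_continuous_on by metis

lemma word_images_small:
  assumes "\<delta> > 0"
  obtains k where "k \<ge> 1"
    "\<And>v x y. v \<in> Pi {0<..k} I \<Longrightarrow> x \<in> X \<Longrightarrow> y \<in> X \<Longrightarrow>
      dist (word_map f 0 k v x) (word_map f 0 k v y) < \<delta>"
proof -
  obtain c where c: "0 \<le> c" "c < 1"
    "\<And>k v. v \<in> Pi {0<..k} I \<Longrightarrow> (c ^ k)-lipschitz_on X (word_map f 0 k v)"
    using word_maps_contract by blast
  have "(\<lambda>k. c ^ k * diameter X) \<longlonglongrightarrow> 0 * diameter X"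
    using c by (intro tendsto_intros LIMSEQ_realpow_zero) auto
  then have "\<forall>\<^sub>F k in sequentially. c ^ k * diameter X < \<delta>"
    using \<open>\<delta> > 0\<close> order_tendstoD(2) by fastforce
  then have "\<forall>\<^sub>F k in sequentially. k \<ge> 1 \<and> c ^ k * diameter X < \<delta>"
    using eventually_ge_at_top[of 1] by eventually_elim simp
  then obtain k where k: "k \<ge> 1" "c ^ k * diameter X < \<delta>"
    by (auto simp: eventually_sequentially)
  have "dist (word_map f 0 k v x) (word_map f 0 k v y) < \<delta>"
    if "v \<in> Pi {0<..k} I" "x \<in> X" "y \<in> X" for v x y
  proof -
    have "dist (word_map f 0 k v x) (word_map f 0 k v y) \<le> c ^ k * dist x y"
      using c(3) that lipschitz_onD by blast
    also have "\<dots> \<le> c ^ k * diameter X"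
      using c that compact_space
      by (intro mult_left_mono diameter_bounded_bound) (auto simp: compact_imp_bounded)
    finally show ?thesis using k by simp
  qed
  with k(1) show thesis by (rule that)
qed

text \<open>The description of \<open>coding_map\<close> is proper: the intersection is indeed a singleton.\<close>

lemma Inter_word_images:
  assumes w: "w \<in> Pi {1..} I"
  shows "(\<Inter>j\<in>{1..}. word_map f 0 j w ` X) = {coding_map X f w}"
proof -
  let ?P = "\<lambda>j. word_map f 0 j w ` X"
  have w': "w \<in> Pi {0<..j} I" for j
    using w by auto
  have "(\<Inter>n. ?P n) \<noteq> {}"
  proof (rule nested_compact_Inter_nonempty)
    show "compact (?P n)" for n
      using w' compact_space continuous_on_word_map by (blast intro: compact_continuous_image)
    show "?P n \<noteq> {}" for n
      using nonempty_space by simp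
    have "f (Suc n) (w (Suc n)) \<in> X \<rightarrow> X" for n
      using self_maps w by auto
    then show "?P (Suc n) \<subseteq> ?P n" for n
      by (auto simp: word_map_Suc)
  qed
  then obtain x where x: "x \<in> ?P n" for n
    by blast
  have "y = x" if "y \<in> (\<Inter>j\<in>{1..}. ?P j)" for y
  proof (rule ccontr)
    assume "y \<noteq> x"
    then obtain k where "k \<ge> 1" and k: "\<And>v x' y'. v \<in> Pi {0<..k} I \<Longrightarrow> x' \<in> X \<Longrightarrow> y' \<in> X \<Longrightarrow>
        dist (word_map f 0 k v x') (word_map f 0 k v y') < dist y x"
      using word_images_small[of "dist y x"] by auto
    then have "y \<in> ?P k" using that by auto
    then show False using x[of k] k[OF w'] by fastforce
  qed
  then have "(\<Inter>j\<in>{1..}. ?P j) = {x}"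
    using x by blast
  then show ?thesis
    by (simp add: coding_map_def)
qed

lemma coding_map_in_word_image:
  assumes w: "w \<in> Pi {1..} I"
  shows "coding_map X f w \<in> word_map f 0 k w ` X"
proof -
  have pos: "coding_map X f w \<in> word_map f 0 j w ` X" if "j \<ge> 1" for j
  proof -
    have "coding_map X f w \<in> (\<Inter>j\<in>{1..}. word_map f 0 j w ` X)"
      by (simp only: Inter_word_images[OF w] singletonI)
    then show ?thesis
      by (rule INT_D) (use that in simp)
  qed
  have "w \<in> Pi {0<..1} I"
    using w by auto
  then have "word_map f 0 1 w ` X \<subseteq> X"
    using word_map_in_space by (intro image_subsetI)
  with pos[of 1] have "coding_map X f w \<in> X"
    by (simp add: subset_iff)
  then show ?thesis
    using pos[of k] by (cases "k = 0") simp_all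
qed

lemma coding_map_eqI:
  assumes "w \<in> Pi {1..} I" "\<And>k. x \<in> word_map f 0 k w ` X"
  shows "coding_map X f w = x"
proof -
  have "x \<in> (\<Inter>k\<in>{1..}. word_map f 0 k w ` X)"
    by (intro INT_I assms(2))
  then show ?thesis
    by (simp only: Inter_word_images[OF assms(1)] singleton_iff)
qed

lemma coding_map_shift:
  assumes w: "w \<in> Pi {1..} I"
  shows "coding_map X f w = f 1 (w 1) (coding_map X (\<lambda>l. f (Suc l)) (\<lambda>l. w (Suc l)))"
proof (rule coding_map_eqI[OF w])
  interpret S: nonautonomous_ifs X "\<lambda>l. I (Suc l)" "\<lambda>l. f (Suc l)"
    using shifted_ifs[of 1] by simp
  have *: "coding_map X (\<lambda>l. f (Suc l)) (\<lambda>l. w (Suc l))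
      \<in> word_map (\<lambda>l. f (Suc l)) 0 k (\<lambda>l. w (Suc l)) ` X" for k
    using w by (intro S.coding_map_in_word_image) auto
  show "f 1 (w 1) (coding_map X (\<lambda>l. f (Suc l)) (\<lambda>l. w (Suc l))) \<in> word_map f 0 k w ` X" for k
  proof (cases k)
    case 0
    have "f 1 (w 1) \<in> X \<rightarrow> X"
      using self_maps w by auto
    with 0 *[of 0] show ?thesis by auto
  next
    case (Suc m)
    with *[of m] show ?thesis
      by (auto simp only: word_map_shift image_comp[symmetric])
  qed
qed

text \<open>
  One step of self-similarity. A code sequence is a function on \<open>{1..}\<close> extended by \<open>undefined\<close>, so
  shifting it requires a new restriction at 0.
\<close>

lemma limit_set_step:
  "limit_set X I f = (\<Union>i\<in>I 1. f 1 i ` limit_set X (\<lambda>l. I (Suc l)) (\<lambda>l. f (Suc l)))"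
proof (intro equalityI subsetI)
  fix x assume "x \<in> limit_set X I f"
  then obtain w where w: "w \<in> Pi\<^sub>E {1..} I" "x = coding_map X f w"
    by (auto simp: limit_set_def)
  let ?w = "\<lambda>l\<in>{1..}. w (Suc l)"
  have "coding_map X (\<lambda>l. f (Suc l)) (\<lambda>l. w (Suc l)) = coding_map X (\<lambda>l. f (Suc l)) ?w"
    by (intro coding_map_cong) simp
  then have "x = f 1 (w 1) (coding_map X (\<lambda>l. f (Suc l)) ?w)"
    using w coding_map_shift[of w] by (auto simp: PiE_def)
  moreover have "?w \<in> Pi\<^sub>E {1..} (\<lambda>l. I (Suc l))" "w 1 \<in> I 1"
    using w(1) by (auto simp: PiE_def)
  ultimately show "x \<in> (\<Union>i\<in>I 1. f 1 i ` limit_set X (\<lambda>l. I (Suc l)) (\<lambda>l. f (Suc l)))"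
    unfolding limit_set_def by blast
next
  fix x assume "x \<in> (\<Union>i\<in>I 1. f 1 i ` limit_set X (\<lambda>l. I (Suc l)) (\<lambda>l. f (Suc l)))"
  then obtain i w where i: "i \<in> I 1" and w: "w \<in> Pi\<^sub>E {1..} (\<lambda>l. I (Suc l))"
    and x: "x = f 1 i (coding_map X (\<lambda>l. f (Suc l)) w)"
    by (auto simp: limit_set_def)
  define u where "u = (\<lambda>l\<in>{1..}. if l = 1 then i else w (l - 1))"
  have "u l \<in> I l" if "l \<ge> 1" for l
  proof (cases "l = 1")
    case False
    then have "w (l - 1) \<in> I (Suc (l - 1))"
      using that by (intro PiE_mem[OF w]) auto
    then show ?thesis using False that by (simp add: u_def)
  qed (use i in \<open>simp add: u_def\<close>)
  then have u: "u \<in> Pi\<^sub>E {1..} I"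
    by (auto simp: u_def)
  have "coding_map X (\<lambda>l. f (Suc l)) (\<lambda>l. u (Suc l)) = coding_map X (\<lambda>l. f (Suc l)) w"
    by (intro coding_map_cong) (simp add: u_def)
  then have "x = coding_map X f u"
    using x u coding_map_shift[of u] by (simp add: PiE_def u_def)
  then show "x \<in> limit_set X I f"
    using u by (auto simp: limit_set_def)
qed

lemma shifted_limit_set_step:
  "shifted_limit_set X I f s =
    (\<Union>i\<in>I (Suc s). f (Suc s) i ` shifted_limit_set X I f (Suc s))"
  using nonautonomous_ifs.limit_set_step[OF shifted_ifs[of s]]
  by (simp add: shifted_limit_set_def)

lemma limit_set_subset: "limit_set X I f \<subseteq> X"
proof -
  have "coding_map X f w \<in> X" if "w \<in> Pi {1..} I" for w
    using coding_map_in_word_image[OF that, of 0] by simp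
  then show ?thesis
    unfolding limit_set_def by (auto simp: PiE_def)
qed

lemma shifted_limit_set_subset: "shifted_limit_set X I f s \<subseteq> X"
  unfolding shifted_limit_set_def by (rule nonautonomous_ifs.limit_set_subset[OF shifted_ifs])

lemma shifted_limit_set_nonempty: "shifted_limit_set X I f s \<noteq> {}"
  by (auto simp: shifted_limit_set_def limit_set_def PiE_eq_empty_iff nonempty_index)

text \<open>
  Among the families of subsets of \<open>X\<close> with the self-similarity inclusions, the limit sets \<open>J\<^sub>s\<close> form
  the largest one: following preimages from a point of \<open>K 0\<close> produces a code for that point.
\<close>

lemma subset_limit_setI:
  fixes K :: "nat \<Rightarrow> 'a set"
  assumes K: "\<And>s. K s \<subseteq> X"
    and step: "\<And>s. K s \<subseteq> (\<Union>i\<in>I (Suc s). f (Suc s) i ` K (Suc s))"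
  shows "K 0 \<subseteq> limit_set X I f"
proof
  fix x assume x: "x \<in> K 0"
  have "\<exists>p. \<forall>n. (p n \<in> K n \<and> (n = 0 \<longrightarrow> p n = x)) \<and>
      (\<exists>i\<in>I (Suc n). p n = f (Suc n) i (p (Suc n)))"
    using x step by (intro dependent_nat_choice) blast+
  then obtain p where p: "\<And>n. p n \<in> K n" "p 0 = x"
    "\<And>n. \<exists>i\<in>I (Suc n). p n = f (Suc n) i (p (Suc n))"
    by auto
  obtain i where i: "\<And>n. i n \<in> I (Suc n)" "\<And>n. p n = f (Suc n) (i n) (p (Suc n))"
    using p(3) by metis
  define w where "w = (\<lambda>l\<in>{1..}. i (l - 1))"
  have "w l \<in> I l" if "l \<ge> 1" for l
    using i(1)[of "l - 1"] that by (simp add: w_def)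
  then have w: "w \<in> Pi\<^sub>E {1..} I"
    by (auto simp: w_def)
  have "x = word_map f 0 k w (p k)" for k
  proof (induction k)
    case (Suc k)
    then show ?case
      using i(2)[of k] by (simp add: word_map_Suc w_def)
  qed (simp add: p)
  then have "x \<in> word_map f 0 k w ` X" for k
    using p(1)[of k] K by blast
  then have "coding_map X f w = x"
    using w by (intro coding_map_eqI) (auto simp: PiE_def)
  then show "x \<in> limit_set X I f"
    using w by (auto simp: limit_set_def)
qed

text \<open>
  The closures of the sets \<open>J\<^sub>s\<close> satisfy the same self-similarity inclusions as the \<open>J\<^sub>s\<close>, because the
  index sets are finite. So the closure of \<open>J\<close> is contained in \<open>J\<close>.
\<close>

lemma compact_limit_set: "compact (limit_set X I f)"
proof -
  let ?J = "shifted_limit_set X I f"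
  have sub: "closure (?J s) \<subseteq> X" for s
    by (intro closure_minimal shifted_limit_set_subset compact_imp_closed compact_space)
  have "closure (?J 0) \<subseteq> limit_set X I f"
  proof (rule subset_limit_setI)
    fix s
    let ?U = "\<Union>i\<in>I (Suc s). f (Suc s) i ` closure (?J (Suc s))"
    have "compact (f (Suc s) i ` closure (?J (Suc s)))" if "i \<in> I (Suc s)" for i
    proof (rule compact_continuous_image)
      have "continuous_on X (f (Suc s) i)"
        using that uniformly_contracting lipschitz_on_continuous_on
        by (metis le_add1 plus_1_eq_Suc)
      then show "continuous_on (closure (?J (Suc s))) (f (Suc s) i)"
        using sub continuous_on_subset by blast
      show "compact (closure (?J (Suc s)))"
        using sub compact_space by (metis closed_closure compact_Int_closed inf.absorb2)
    qed
    then have "closed ?U"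
      using finite_index by (intro compact_imp_closed compact_UN) auto
    moreover have "?J s \<subseteq> ?U"
      using closure_subset by (subst shifted_limit_set_step) blast
    ultimately show "closure (?J s) \<subseteq> ?U"
      by (rule closure_minimal[rotated])
  qed (rule sub)
  then have "closed (limit_set X I f)"
    by (metis closure_subset_eq shifted_limit_set_0)
  then show ?thesis
    using limit_set_subset compact_space by (metis compact_Int_closed inf.absorb2)
qed

lemma compact_shifted_limit_set: "compact (shifted_limit_set X I f s)"
  unfolding shifted_limit_set_def by (rule nonautonomous_ifs.compact_limit_set[OF shifted_ifs])

end

section \<open>Components of simplicial complexes\<close>

lemma vertex_class_self: "v \<in> vertices K \<Longrightarrow> v \<in> vertex_class K v"
  by (simp add: vertex_class_def)

lemma vertex_class_eq:
  assumes "u \<in> vertex_class K v"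
  shows "vertex_class K u = vertex_class K v"
  using assms unfolding vertex_class_def by (blast intro: equivclp_trans equivclp_sym)

lemma simplex_in_vertex_class:
  assumes "{u, v} \<in> K"
  shows "v \<in> vertex_class K u"
proof -
  have "equivclp (\<lambda>x y. x \<noteq> y \<and> {x, y} \<in> K) u v"
    using assms by (cases "u = v") auto
  moreover have "v \<in> vertices K"
    using assms by (auto simp: vertices_def)
  ultimately show ?thesis by (simp add: vertex_class_def)
qed

lemma vertices_complex_component:
  assumes "\<And>u. u \<in> vertices K \<Longrightarrow> {u} \<in> K"
  shows "vertices (complex_component K v) = vertex_class K v"
proof (intro equalityI subsetI)
  fix u assume "u \<in> vertex_class K v"
  moreover from this have "{u} \<in> K"
    using assms by (simp add: vertex_class_def)
  ultimately show "u \<in> vertices (complex_component K v)"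
    unfolding vertices_def complex_component_def by blast
qed (auto simp: vertices_def complex_component_def)

lemma complex_component_of_vertex:
  assumes vertex_simplex: "\<And>u. u \<in> vertices K \<Longrightarrow> {u} \<in> K"
    and "D \<in> complex_components K" and "v \<in> vertices D"
  shows "D = complex_component K v" and "v \<in> vertices K"
proof -
  obtain u where u: "D = complex_component K u"
    using assms(2) by (auto simp: complex_components_def)
  have "v \<in> vertex_class K u"
    using \<open>v \<in> vertices D\<close> vertices_complex_component[OF vertex_simplex] by (simp add: u)
  then show "D = complex_component K v" "v \<in> vertices K"
    by (simp_all add: u complex_component_def vertex_class_eq) (simp add: vertex_class_def)
qed

section \<open>Pieces of the limit set\<close>

context nonautonomous_ifs
begin

text \<open>The set \<open>f\<^sub>v(J\<^sub>k)\<close> for a word \<open>v\<close> on the levels \<open>1, \<dots>, k\<close>.\<close>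

definition piece :: "nat \<Rightarrow> (nat \<Rightarrow> 'i) \<Rightarrow> 'a set" where
  "piece k v = word_map f 0 k v ` shifted_limit_set X I f k"

text \<open>The union of the pieces that belong to the vertices of a complex \<open>D\<close>.\<close>

definition body :: "nat \<Rightarrow> (nat \<Rightarrow> 'i) set set \<Rightarrow> 'a set" where
  "body k D = (\<Union>v\<in>vertices D. piece k v)"

lemma words_Pi: "v \<in> words I 0 k \<Longrightarrow> v \<in> Pi {0<..k} I"
  by (simp add: words_def PiE_def)

lemma finite_words: "finite (words I 0 k)"
  unfolding words_def by (intro finite_PiE) (auto simp: finite_index)

lemma piece_nonempty: "piece k v \<noteq> {}"
  by (simp add: piece_def shifted_limit_set_nonempty)

lemma compact_piece:
  assumes "v \<in> words I 0 k"
  shows "compact (piece k v)"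
  unfolding piece_def
proof (rule compact_continuous_image)
  show "continuous_on (shifted_limit_set X I f k) (word_map f 0 k v)"
    using continuous_on_word_map[OF words_Pi[OF assms]] shifted_limit_set_subset
    by (rule continuous_on_subset)
qed (rule compact_shifted_limit_set)

lemma restrict_in_words: "v \<in> words I 0 (Suc k) \<Longrightarrow> restrict v {0<..k} \<in> words I 0 k"
  by (auto simp: words_def PiE_def Pi_iff)

lemma piece_Suc:
  assumes "v \<in> words I 0 (Suc k)"
  shows "piece (Suc k) v \<subseteq> piece k (restrict v {0<..k})"
proof -
  have v: "v (Suc k) \<in> I (Suc k)"
    using words_Pi[OF assms] by (auto simp: Pi_iff)
  have "word_map f 0 (Suc k) v = word_map f 0 k (restrict v {0<..k}) \<circ> f (Suc k) (v (Suc k))"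
    unfolding word_map_Suc[OF le0]
    by (rule arg_cong[where f = "\<lambda>g. g \<circ> _"], rule word_map_cong) simp
  moreover have "f (Suc k) (v (Suc k)) ` shifted_limit_set X I f (Suc k)
      \<subseteq> shifted_limit_set X I f k"
    using v shifted_limit_set_step[of k] by blast
  ultimately show ?thesis
    unfolding piece_def by (auto simp only: image_comp[symmetric])
qed

lemma limit_set_eq_pieces: "limit_set X I f = (\<Union>v\<in>words I 0 k. piece k v)"
proof (induction k)
  case 0
  then show ?case
    by (simp add: words_def piece_def shifted_limit_set_0)
next
  case (Suc k)
  show ?case
  proof
    show "limit_set X I f \<subseteq> (\<Union>v\<in>words I 0 (Suc k). piece (Suc k) v)"
    proof
      fix x assume "x \<in> limit_set X I f"
      then obtain v y where v: "v \<in> words I 0 k" "x = word_map f 0 k v y"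
        and "y \<in> shifted_limit_set X I f k"
        by (auto simp: Suc piece_def)
      then obtain i z where i: "i \<in> I (Suc k)" "y = f (Suc k) i z"
        and z: "z \<in> shifted_limit_set X I f (Suc k)"
        using shifted_limit_set_step[of k] by blast
      let ?u = "v(Suc k := i)"
      have "{0<..Suc k} = insert (Suc k) {0<..k}"
        by auto
      then have "?u \<in> words I 0 (Suc k)"
        using v i PiE_fun_upd[of i I "Suc k" v "{0<..k}"] by (simp add: words_def)
      moreover have "word_map f 0 k ?u = word_map f 0 k v"
        by (rule word_map_cong) simp
      then have "x = word_map f 0 (Suc k) ?u z"
        using v i by (simp add: word_map_Suc)
      ultimately show "x \<in> (\<Union>v\<in>words I 0 (Suc k). piece (Suc k) v)"
        using z unfolding piece_def by blast
    qed
    show "(\<Union>v\<in>words I 0 (Suc k). piece (Suc k) v) \<subseteq> limit_set X I f"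
      using piece_Suc[of _ k] restrict_in_words[of _ k] unfolding Suc by blast
  qed
qed

lemma pieces_small:
  assumes "\<delta> > 0"
  obtains k where "k \<ge> 1"
    "\<And>v x y. v \<in> words I 0 k \<Longrightarrow> x \<in> piece k v \<Longrightarrow> y \<in> piece k v \<Longrightarrow> dist x y < \<delta>"
proof -
  obtain k where k: "k \<ge> 1"
    "\<And>v x y. v \<in> Pi {0<..k} I \<Longrightarrow> x \<in> X \<Longrightarrow> y \<in> X \<Longrightarrow>
      dist (word_map f 0 k v x) (word_map f 0 k v y) < \<delta>"
    using word_images_small[OF assms] by blast
  have "dist x y < \<delta>" if "v \<in> words I 0 k" "x \<in> piece k v" "y \<in> piece k v" for v x y
    using k(2)[OF words_Pi[OF that(1)]] that(2,3) shifted_limit_set_subset[of k]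
    unfolding piece_def by blast
  with k(1) show thesis by (rule that)
qed

section \<open>Components of the nerves\<close>

lemma in_nerve_iff:
  "s \<in> nerve X I f 0 k \<longleftrightarrow>
    s \<noteq> {} \<and> finite s \<and> s \<subseteq> words I 0 k \<and> (\<Inter>v\<in>s. piece k v) \<noteq> {}"
  by (simp add: nerve_def piece_def)

lemma vertex_in_nerve: "u \<in> vertices (nerve X I f 0 k) \<Longrightarrow> {u} \<in> nerve X I f 0 k"
  by (simp add: in_nerve_iff vertices_nerve piece_nonempty)

lemma edge_in_nerve:
  assumes "u \<in> words I 0 k" "v \<in> words I 0 k" "x \<in> piece k u" "x \<in> piece k v"
  shows "{u, v} \<in> nerve X I f 0 k"
  using assms by (auto simp: in_nerve_iff)

lemma nerve_component_of_vertex: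
  assumes "D \<in> nerve_components X I f k" "v \<in> vertices D"
  shows "D = complex_component (nerve X I f 0 k) v" and "v \<in> words I 0 k"
  using complex_component_of_vertex[of "nerve X I f 0 k", OF vertex_in_nerve] assms
  by (auto simp: nerve_components_def vertices_nerve)

lemma complex_component_in_nerve_components:
  "v \<in> words I 0 k \<Longrightarrow> complex_component (nerve X I f 0 k) v \<in> nerve_components X I f k"
  by (simp add: nerve_components_def complex_components_def vertices_nerve)

lemma vertices_nerve_component:
  "vertices (complex_component (nerve X I f 0 k) v) = vertex_class (nerve X I f 0 k) v"
  by (rule vertices_complex_component) (rule vertex_in_nerve)

lemma nerve_component_nonempty:
  assumes "D \<in> nerve_components X I f k"
  shows "vertices D \<noteq> {}"
proof -
  obtain v where "v \<in> vertices (nerve X I f 0 k)" "D = complex_component (nerve X I f 0 k) v"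
    using assms by (auto simp: nerve_components_def complex_components_def)
  then show ?thesis
    using vertex_class_self[of v "nerve X I f 0 k"] by (auto simp: vertices_nerve_component)
qed

lemma finite_nerve_components: "finite (nerve_components X I f k)"
  by (simp add: nerve_components_def complex_components_def vertices_nerve finite_words)

lemma compact_body:
  assumes "D \<in> nerve_components X I f k"
  shows "compact (body k D)"
proof -
  have D: "vertices D \<subseteq> words I 0 k"
    using nerve_component_of_vertex(2)[OF assms] by blast
  then have "finite (vertices D)"
    using finite_words finite_subset by blast
  then show ?thesis
    unfolding body_def using D by (intro compact_UN) (auto simp: compact_piece)
qed

lemma body_nonempty: "D \<in> nerve_components X I f k \<Longrightarrow> body k D \<noteq> {}"
  using nerve_component_nonempty piece_nonempty by (simp add: body_def)

lemma bodies_disjoint: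
  assumes D: "D \<in> nerve_components X I f k" and D': "D' \<in> nerve_components X I f k"
    and "x \<in> body k D" "x \<in> body k D'"
  shows "D = D'"
proof -
  obtain u v where uv: "u \<in> vertices D" "v \<in> vertices D'" "x \<in> piece k u" "x \<in> piece k v"
    using assms(3,4) by (auto simp: body_def)
  have "{u, v} \<in> nerve X I f 0 k"
    using edge_in_nerve uv nerve_component_of_vertex(2) D D' by metis
  then have "vertex_class (nerve X I f 0 k) v = vertex_class (nerve X I f 0 k) u"
    by (intro vertex_class_eq simplex_in_vertex_class)
  moreover have "D = complex_component (nerve X I f 0 k) u" "D' = complex_component (nerve X I f 0 k) v"
    using nerve_component_of_vertex(1) D D' uv by blast+
  ultimately show ?thesis
    by (simp add: complex_component_def)
qed

lemma limit_set_eq_bodies: "limit_set X I f = (\<Union>D\<in>nerve_components X I f k. body k D)"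
proof
  have "piece k v \<subseteq> body k (complex_component (nerve X I f 0 k) v)" if "v \<in> words I 0 k" for v
    unfolding body_def vertices_nerve_component
    by (rule UN_upper, rule vertex_class_self) (simp add: vertices_nerve that)
  then show "limit_set X I f \<subseteq> (\<Union>D\<in>nerve_components X I f k. body k D)"
    unfolding limit_set_eq_pieces[of k]
    using complex_component_in_nerve_components by blast
  show "(\<Union>D\<in>nerve_components X I f k. body k D) \<subseteq> limit_set X I f"
    unfolding limit_set_eq_pieces[of k] body_def
    using nerve_component_of_vertex(2) by blast
qed

text \<open>
  The bodies of the nerve components at a fixed level form a finite partition of \<open>J\<close> into closed
  sets, so a connected subset lies in exactly one of them.
\<close>

lemma connected_in_unique_body:
  assumes C: "connected C" "C \<noteq> {}" "C \<subseteq> limit_set X I f"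
  shows "\<exists>!D. D \<in> nerve_components X I f k \<and> C \<subseteq> body k D"
proof -
  let ?N = "nerve_components X I f k"
  obtain x where x: "x \<in> C"
    using C by blast
  then obtain D where D: "D \<in> ?N" "x \<in> body k D"
    using C limit_set_eq_bodies[of k] by blast
  let ?R = "\<Union>D'\<in>?N - {D}. body k D'"
  have closed: "closed (body k D)" "closed ?R"
    using D by (auto intro!: closed_UN compact_imp_closed compact_body finite_Diff finite_nerve_components)
  have cover: "C \<subseteq> body k D \<union> ?R"
    using C limit_set_eq_bodies[of k] by blast
  have "body k D \<inter> ?R \<inter> C = {}"
    using D bodies_disjoint by blast
  then have "body k D \<inter> C = {} \<or> ?R \<inter> C = {}"
    using connected_closedD[OF C(1) _ cover closed] by simp
  then have "C \<subseteq> body k D"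
    using x D cover by blast
  then show ?thesis
    using D x bodies_disjoint by blast
qed

lemma restrict_simplex:
  assumes "s \<in> nerve X I f 0 (Suc k)"
  shows "(\<lambda>v. restrict v {0<..k}) ` s \<in> nerve X I f 0 k"
proof -
  have s: "s \<noteq> {}" "finite s" "s \<subseteq> words I 0 (Suc k)"
    using assms by (auto simp: in_nerve_iff)
  obtain x where "\<And>v. v \<in> s \<Longrightarrow> x \<in> piece (Suc k) v"
    using assms by (auto simp: in_nerve_iff)
  then have "x \<in> piece k (restrict v {0<..k})" if "v \<in> s" for v
    using that s piece_Suc by blast
  then have "x \<in> (\<Inter>v\<in>(\<lambda>v. restrict v {0<..k}) ` s. piece k v)"
    by blast
  then show ?thesis
    using s restrict_in_words unfolding in_nerve_iff by blast
qed

lemma bonding_map_vertex: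
  assumes "D \<in> nerve_components X I f (Suc k)" "v \<in> vertices D"
  shows "bonding_map X I f k D = complex_component (nerve X I f 0 k) (restrict v {0<..k})"
  unfolding nerve_component_of_vertex(1)[OF assms] bonding_map_def
proof (rule component_map_complex_component)
  show "v \<in> vertices (nerve X I f 0 (Suc k))"
    using nerve_component_of_vertex(2)[OF assms] by (simp add: vertices_nerve)
qed (fact restrict_simplex vertex_in_nerve)+

lemma bonding_map_in_nerve_components:
  assumes D: "D \<in> nerve_components X I f (Suc k)"
  shows "bonding_map X I f k D \<in> nerve_components X I f k"
proof -
  obtain v where v: "v \<in> vertices D"
    using nerve_component_nonempty[OF D] by blast
  show ?thesis
    unfolding bonding_map_vertex[OF D v]
    by (intro complex_component_in_nerve_components restrict_in_words
        nerve_component_of_vertex(2)[OF D v])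
qed

lemma body_bonding_map:
  assumes D: "D \<in> nerve_components X I f (Suc k)"
  shows "body (Suc k) D \<subseteq> body k (bonding_map X I f k D)"
proof
  fix x assume "x \<in> body (Suc k) D"
  then obtain v where v: "v \<in> vertices D" "x \<in> piece (Suc k) v"
    by (auto simp: body_def)
  have words: "v \<in> words I 0 (Suc k)"
    using nerve_component_of_vertex(2)[OF D v(1)] .
  then have "restrict v {0<..k} \<in> vertices (bonding_map X I f k D)"
    unfolding bonding_map_vertex[OF D v(1)] vertices_nerve_component
    by (intro vertex_class_self) (simp add: vertices_nerve restrict_in_words)
  then show "x \<in> body k (bonding_map X I f k D)"
    using v piece_Suc[OF words] unfolding body_def by blast
qed

text \<open>
  Points of different components of \<open>J\<close> lie in closed parts of \<open>J\<close> at a positive distance \<open>\<delta>\<close>.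
  At a level where all pieces are smaller than \<open>\<delta>\<close>, edges of the nerve cannot lead from one
  part to the other.
\<close>

lemma components_in_different_bodies:
  assumes C: "C \<in> components (limit_set X I f)" and C': "C' \<in> components (limit_set X I f)"
    and "C \<noteq> C'"
  obtains k where "k \<ge> 1"
    "\<And>D. D \<in> nerve_components X I f k \<Longrightarrow> C \<subseteq> body k D \<Longrightarrow> \<not> C' \<subseteq> body k D"
proof -
  obtain A B \<delta> where AB: "A \<union> B = limit_set X I f" "C \<inter> A \<noteq> {}" "C' \<inter> B \<noteq> {}" and "\<delta> > 0"
    and dist: "\<And>a b. a \<in> A \<Longrightarrow> b \<in> B \<Longrightarrow> \<delta> \<le> dist a b"
    using components_compact_separated[OF compact_limit_set C C' \<open>C \<noteq> C'\<close>] by metis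
  obtain k where "k \<ge> 1" and small:
    "\<And>v x y. v \<in> words I 0 k \<Longrightarrow> x \<in> piece k v \<Longrightarrow> y \<in> piece k v \<Longrightarrow> dist x y < \<delta>"
    using pieces_small[OF \<open>\<delta> > 0\<close>] by blast
  have piece_A: "piece k v \<subseteq> A" if v: "v \<in> words I 0 k" and x: "x \<in> piece k v" "x \<in> A" for v x
  proof
    fix y assume y: "y \<in> piece k v"
    then have "y \<notin> B"
      using dist[OF x(2)] small[OF v x(1) y] by force
    moreover have "y \<in> limit_set X I f"
      using limit_set_eq_pieces[of k] v y by blast
    ultimately show "y \<in> A"
      using AB by blast
  qed
  have "\<not> C' \<subseteq> body k D" if D: "D \<in> nerve_components X I f k" and CD: "C \<subseteq> body k D" for D
  proof
    assume "C' \<subseteq> body k D"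
    then obtain b v where b: "b \<in> B" "v \<in> vertices D" "b \<in> piece k v"
      using AB unfolding body_def by blast
    obtain a u where a: "a \<in> A" "u \<in> vertices D" "a \<in> piece k u"
      using AB CD unfolding body_def by blast
    have "v \<in> vertex_class (nerve X I f 0 k) u"
      using b(2) nerve_component_of_vertex(1)[OF D a(2)] vertices_nerve_component by simp
    then have "equivclp (\<lambda>x y. x \<noteq> y \<and> {x, y} \<in> nerve X I f 0 k) u v"
      by (simp add: vertex_class_def)
    \<comment> \<open>Along a path in the nerve, each piece meets its predecessor, hence meets \<open>A\<close>.\<close>
    then have "piece k v \<subseteq> A"
    proof (induction rule: equivclp_induct)
      case base
      show ?case
        using piece_A nerve_component_of_vertex(2)[OF D a(2)] a by blast
    next
      case (step y z)
      then have "{y, z} \<in> nerve X I f 0 k"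
        by (auto simp: insert_commute)
      then obtain x where "z \<in> words I 0 k" "x \<in> piece k y" "x \<in> piece k z"
        by (auto simp: in_nerve_iff)
      then show ?case
        using piece_A step.IH by blast
    qed
    then have "b \<in> A"
      using b by blast
    then show False
      using dist[of b b] b \<open>\<delta> > 0\<close> by simp
  qed
  with \<open>k \<ge> 1\<close> show thesis by (rule that)
qed

lemma inverse_limit_bodies_meet:
  assumes "s \<in> inverse_limit (nerve_components X I f) (bonding_map X I f)"
  obtains x where "x \<in> limit_set X I f" "\<And>k. k \<ge> 1 \<Longrightarrow> x \<in> body k (s k)"
proof -
  have s: "s (Suc n) \<in> nerve_components X I f (Suc n)" for n
    using assms by (auto simp: inverse_limit_def PiE_def Pi_iff)
  have "(\<Inter>n. body (Suc n) (s (Suc n))) \<noteq> {}"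
  proof (rule nested_compact_Inter_nonempty)
    show "body (Suc (Suc n)) (s (Suc (Suc n))) \<subseteq> body (Suc n) (s (Suc n))" for n
      using body_bonding_map[OF s[of "Suc n"]] assms by (simp add: inverse_limit_def)
  qed (use s compact_body body_nonempty in auto)
  then obtain x where x: "\<And>n. x \<in> body (Suc n) (s (Suc n))"
    by blast
  then have "x \<in> body k (s k)" if "k \<ge> 1" for k
    using that by (cases k) auto
  moreover have "x \<in> limit_set X I f"
    using x[of 0] s[of 0] limit_set_eq_bodies[of "Suc 0"] by blast
  ultimately show thesis
    using that by blast
qed

section \<open>The bijection\<close>

text \<open>
  The thread of nerve components whose bodies contain \<open>C\<close>; level 0 is not part of the inverse system
  and gets the value \<open>undefined\<close>.
\<close>

definition component_thread :: "'a set \<Rightarrow> nat \<Rightarrow> (nat \<Rightarrow> 'i) set set" where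
  "component_thread C = (\<lambda>k\<in>{1..}. THE D. D \<in> nerve_components X I f k \<and> C \<subseteq> body k D)"

lemma component_thread_iff:
  assumes C: "C \<in> components (limit_set X I f)" and "k \<ge> 1"
  shows "D = component_thread C k \<longleftrightarrow> D \<in> nerve_components X I f k \<and> C \<subseteq> body k D"
proof -
  have "\<exists>!D. D \<in> nerve_components X I f k \<and> C \<subseteq> body k D"
    using C in_components_connected in_components_nonempty in_components_subset
    by (intro connected_in_unique_body) blast+
  then show ?thesis
    using theI_unique[of "\<lambda>D. D \<in> nerve_components X I f k \<and> C \<subseteq> body k D" D] \<open>k \<ge> 1\<close>
    by (auto simp: component_thread_def)
qed

lemma component_thread_in_inverse_limit:
  assumes C: "C \<in> components (limit_set X I f)"
  shows "component_thread C \<in> inverse_limit (nerve_components X I f) (bonding_map X I f)"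
proof -
  have thread: "component_thread C k \<in> nerve_components X I f k" "C \<subseteq> body k (component_thread C k)"
    if "k \<ge> 1" for k
    using component_thread_iff[OF C that] by blast+
  have "bonding_map X I f k (component_thread C (Suc k)) = component_thread C k" if "k \<ge> 1" for k
    using thread[of "Suc k"] body_bonding_map[of "component_thread C (Suc k)" k]
      bonding_map_in_nerve_components[of "component_thread C (Suc k)" k]
    by (subst component_thread_iff[OF C that]) auto
  moreover have "component_thread C \<in> Pi\<^sub>E {1..} (nerve_components X I f)"
    using thread by (auto simp: PiE_def component_thread_def extensional_def)
  ultimately show ?thesis
    by (simp add: inverse_limit_def)
qed

lemma bij_betw_component_thread:
  "bij_betw component_thread (components (limit_set X I f))
     (inverse_limit (nerve_components X I f) (bonding_map X I f))"
  unfolding bij_betw_def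
proof
  show "inj_on component_thread (components (limit_set X I f))"
  proof (rule inj_onI, rule ccontr)
    fix C C' assume C: "C \<in> components (limit_set X I f)" "C' \<in> components (limit_set X I f)"
      and eq: "component_thread C = component_thread C'" and "C \<noteq> C'"
    then obtain k where "k \<ge> 1" and
      k: "\<And>D. D \<in> nerve_components X I f k \<Longrightarrow> C \<subseteq> body k D \<Longrightarrow> \<not> C' \<subseteq> body k D"
      using components_in_different_bodies by blast
    then show False
      using component_thread_iff[OF C(1) \<open>k \<ge> 1\<close>] component_thread_iff[OF C(2) \<open>k \<ge> 1\<close>] eq by metis
  qed
  have "s \<in> component_thread ` components (limit_set X I f)"
    if s: "s \<in> inverse_limit (nerve_components X I f) (bonding_map X I f)" for s
  proof -
    obtain x where x: "x \<in> limit_set X I f" "\<And>k. k \<ge> 1 \<Longrightarrow> x \<in> body k (s k)"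
      using inverse_limit_bodies_meet[OF s] by blast
    let ?C = "connected_component_set (limit_set X I f) x"
    have C: "?C \<in> components (limit_set X I f)" "x \<in> ?C"
      using x by (auto simp: components_def)
    have s': "s \<in> Pi\<^sub>E {1..} (nerve_components X I f)"
      using s by (simp add: inverse_limit_def)
    have "s k = component_thread ?C k" for k
    proof (cases "k \<ge> 1")
      case True
      then have "component_thread ?C k \<in> nerve_components X I f k"
        "?C \<subseteq> body k (component_thread ?C k)"
        using component_thread_iff[OF C(1)] by blast+
      moreover have "s k \<in> nerve_components X I f k"
        using s' True by (auto simp: PiE_def)
      ultimately show ?thesis
        using bodies_disjoint x(2)[OF True] C(2) by blast
    next
      case False
      then show ?thesis
        using s' by (simp add: component_thread_def PiE_def extensional_def)
    qed
    then show ?thesis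
      using C(1) by (intro image_eqI[of _ _ ?C]) auto
  qed
  then show "component_thread ` components (limit_set X I f)
      = inverse_limit (nerve_components X I f) (bonding_map X I f)"
    using component_thread_in_inverse_limit by blast
qed

end

theorem theorem4p6:
  fixes X :: "'a::metric_space set"
    and I :: "nat \<Rightarrow> 'i set"
    and f :: "nat \<Rightarrow> 'i \<Rightarrow> 'a \<Rightarrow> 'a"
  assumes "nonautonomous_ifs X I f"
  shows "\<exists>F. bij_betw F (components (limit_set X I f))
               (inverse_limit (nerve_components X I f) (bonding_map X I f)) \<and>
             (\<forall>C\<in>components (limit_set X I f). \<forall>k\<ge>1. \<forall>D\<in>nerve_components X I f k.
                C \<subseteq> (\<Union>v\<in>vertices D. word_map f 0 k v ` shifted_limit_set X I f k)
                \<longleftrightarrow> D = F C k)"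
proof -
  interpret nonautonomous_ifs X I f
    by (rule assms)
  have "C \<subseteq> (\<Union>v\<in>vertices D. word_map f 0 k v ` shifted_limit_set X I f k)
      \<longleftrightarrow> D = component_thread C k"
    if "C \<in> components (limit_set X I f)" "k \<ge> 1" "D \<in> nerve_components X I f k" for C k D
    using component_thread_iff[OF that(1,2)] that(3) by (simp add: body_def piece_def)
  then show ?thesis
    using bij_betw_component_thread by blast
qed

end
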